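(* Let $X=\{-1,1\}^{\mathbb N}$. Let $(w_n)_{n\ge0}$ be a sequence of real numbers taking a finite number of (pairwise distinct) values $v_0,v_1,\dots,v_m$, and let $$f_n(x)=x_n\,g_n(x_{n+1},x_{n+2},\dots)\qquad(n\ge0).$$ Suppose that (C1) all $g_n$ take values in $\{-1,1\}$ and there is an integer $L\ge1$ such that, for every $n$, $g_n(x_{n+1},x_{n+2},\dots)$ depends only on $x_{n+1},\dots,x_{n+L}$; (C2) the following frequencies exist: $$p_j:=\lim_{N\to\infty}\frac{\#\{1\le n\le N:\ w_n=v_j\}}{N}\qquad(0\le j\le m).$$ For $\alpha\in\mathbb R$ let $$E(\alpha)=\Big\{x\in X:\ \lim_{N\to\infty}\frac1N\sum_{n=0}^{N-1}w_nf_n(x)=\alpha\Big\}.$$ Then for every $\alpha\in\big(-\sum_jp_j|v_j|,\ \sum_jp_j|v_j|\big)$ the equation $$\sum_{j=0}^mp_jv_j\frac{e^{\lambda v_j}-e^{-\lambda v_j}}{e^{\lambda v_j}+e^{-\lambda v_j}}=\alpha$$ has a unique solution $\lambda=\lambda_\alpha\in\mathbb R$, and $$\dim E(\alpha)=\frac1{\log2}\sum_{j=0}^mp_j\left(\log(e^{\lambda_\alpha v_j}+e^{-\lambda_\alpha v_j})-\lambda_\alpha v_j\frac{e^{\lambda_\alpha v_j}-e^{-\lambda_\alpha v_j}}{e^{\lambda_\alpha v_j}+e^{-\lambda_\alpha v_j}}\right).$$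
   Context: Points of $X$ are sequences $x=(x_n)_{n\ge0}$. $\dim$ is Hausdorff dimension with respect to the metric $d(x,y)=2^{-n}$, where $n$ is the least $k$ with $x_k\ne y_k$ (and $d(x,x)=0$). *)

theory Defs
  imports "HOL-Analysis.Analysis"
begin

section \<open>Hausdorff dimension of subsets of a metric space\<close>

text \<open>A metric space is given, as in the library locale \<^locale>\<open>Metric_space\<close>, by its carrier
  \<open>M\<close> and its distance function \<open>d\<close>.  (The type class \<open>metric_space\<close> does not serve here: the
  metric it carries on function types is not the one used for sequences below.)\<close>

definition set_diam :: "('a \<Rightarrow> 'a \<Rightarrow> real) \<Rightarrow> 'a set \<Rightarrow> ennreal" where
  "set_diam d U = (SUP x\<in>U. SUP y\<in>U. ennreal (d x y))"

text \<open>\<open>diam(U)\<^sup>s\<close> for a set of finite diameter, with the usual conventions that the empty set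
  always contributes \<open>0\<close> and that \<open>0\<^sup>0 = 1\<close> for nonempty \<open>U\<close> (whereas \<open>0 powr 0 = 0\<close>).\<close>

definition diam_pow :: "('a \<Rightarrow> 'a \<Rightarrow> real) \<Rightarrow> real \<Rightarrow> 'a set \<Rightarrow> ennreal" where
  "diam_pow d s U =
     (if U = {} then 0 else if s = 0 then 1 else ennreal (enn2real (set_diam d U) powr s))"

text \<open>Sequences of sets also cover the case of finite covers, since members may be empty.\<close>

definition hausdorff_premeasure ::
    "'a set \<Rightarrow> ('a \<Rightarrow> 'a \<Rightarrow> real) \<Rightarrow> real \<Rightarrow> real \<Rightarrow> 'a set \<Rightarrow> ennreal" where
  "hausdorff_premeasure M d s \<delta> E =
     Inf {(\<Sum>i. diam_pow d s (U i)) | U :: nat \<Rightarrow> 'a set.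
            E \<subseteq> (\<Union>i. U i) \<and> (\<forall>i. U i \<subseteq> M \<and> set_diam d (U i) \<le> ennreal \<delta>)}"

definition hausdorff_measure ::
    "'a set \<Rightarrow> ('a \<Rightarrow> 'a \<Rightarrow> real) \<Rightarrow> real \<Rightarrow> 'a set \<Rightarrow> ennreal" where
  "hausdorff_measure M d s E = (SUP \<delta>\<in>{0<..}. hausdorff_premeasure M d s \<delta> E)"

definition hausdorff_dim :: "'a set \<Rightarrow> ('a \<Rightarrow> 'a \<Rightarrow> real) \<Rightarrow> 'a set \<Rightarrow> ereal" where
  "hausdorff_dim M d E = Inf {ereal s | s. 0 \<le> s \<and> hausdorff_measure M d s E = 0}"


section \<open>The space of sign sequences\<close>

definition sign_seqs :: "(nat \<Rightarrow> real) set" where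
  "sign_seqs = {x. \<forall>n. x n \<in> {-1, 1}}"

definition seq_dist :: "(nat \<Rightarrow> 'a) \<Rightarrow> (nat \<Rightarrow> 'a) \<Rightarrow> real" where
  "seq_dist x y = (if x = y then 0 else (1/2) ^ (LEAST k. x k \<noteq> y k))"

lemma Metric_space_seq_dist: "Metric_space M seq_dist"
proof
  fix x y z :: "nat \<Rightarrow> 'a"
  show "0 \<le> seq_dist x y" by (simp add: seq_dist_def)
  show "seq_dist x y = seq_dist y x"
    by (simp add: seq_dist_def eq_commute[of x] eq_commute[of "x _"])
  show "seq_dist x y = 0 \<longleftrightarrow> x = y" by (simp add: seq_dist_def)
  show "seq_dist x z \<le> seq_dist x y + seq_dist y z"
  proof (cases "x = z \<or> x = y \<or> y = z")
    case True
    then show ?thesis by (auto simp: seq_dist_def)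
  next
    case False
    define k where "k = (LEAST k. x k \<noteq> z k)"
    define a where "a = (LEAST k. x k \<noteq> y k)"
    define b where "b = (LEAST k. y k \<noteq> z k)"
    from False obtain i where "x i \<noteq> z i" by blast
    then have "x k \<noteq> z k" unfolding k_def by (rule LeastI)
    then have "x k \<noteq> y k \<or> y k \<noteq> z k" by metis
    then have "a \<le> k \<or> b \<le> k" unfolding a_def b_def by (blast intro: Least_le)
    then have "(1/2::real) ^ k \<le> (1/2) ^ a \<or> (1/2::real) ^ k \<le> (1/2) ^ b"
      by (auto intro: power_decreasing)
    moreover have "0 \<le> (1/2::real) ^ a" "0 \<le> (1/2::real) ^ b" by simp_all
    ultimately have "(1/2::real) ^ k \<le> (1/2) ^ a + (1/2) ^ b" by linarith
    then show ?thesis using False by (simp add: seq_dist_def k_def a_def b_def)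
  qed
qed

definition level_set ::
    "(nat \<Rightarrow> real) \<Rightarrow> (nat \<Rightarrow> (nat \<Rightarrow> real) \<Rightarrow> real) \<Rightarrow> real \<Rightarrow> (nat \<Rightarrow> real) set" where
  "level_set w f \<alpha> =
     {x \<in> sign_seqs. (\<lambda>N. (1 / real N) * (\<Sum>n<N. w n * f n x)) \<longlonglongrightarrow> \<alpha>}"

end

theory Submission
  imports Defs "HOL-Probability.Probability" "HOL-Real_Asymp.Real_Asymp"
begin

text \<open>Put \<open>y\<^sub>n = f\<^sub>n(x)\<close>.  The first \<open>N + L\<close> coordinates of \<open>x\<close> determine the first \<open>N\<close> signs \<open>y\<^sub>n\<close>; conversely,
  as \<open>y\<^sub>n\<close> is \<open>x\<^sub>n\<close> times a sign depending only on the next \<open>L\<close> coordinates, these \<open>N\<close> signs together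
  with the last \<open>L\<close> of the \<open>N + L\<close> coordinates determine all of them.  By compactness every sign
  sequence \<open>y\<close> is attained.  So up to a bounded factor one may work with free signs \<open>y\<^sub>n\<close>.  The upper
  bound counts the words \<open>y\<close> of length \<open>N\<close> with \<open>\<Sum> w\<^sub>n y\<^sub>n\<close> close to \<open>N \<alpha>\<close> by the exponential Chebyshev
  inequality with parameter \<open>\<lambda>\<close>.  For the lower bound let the \<open>y\<^sub>n\<close>
  be independent with \<open>P(y\<^sub>n = \<plusminus>1)\<close> proportional to \<open>exp (\<plusminus>\<lambda> w\<^sub>n)\<close>: by the strong law of large numbers
  \<open>y\<close> almost surely comes from a point of \<open>E(\<alpha>)\<close>, and there the mass of a cylinder of length \<open>N\<close> is
  \<open>exp (\<lambda> \<Sum> w\<^sub>n y\<^sub>n - \<Sum> ln (2 cosh (\<lambda> w\<^sub>n)))\<close>, which is \<open>2\<close> to the power \<open>- N (dim + o(1))\<close>.\<close>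

section \<open>Coding by free signs\<close>

lemma seq_dist_le_iff_agree: "seq_dist x y \<le> (1/2) ^ N \<longleftrightarrow> (\<forall>k<N. x k = y k)"
proof (cases "x = y")
  case False
  then obtain i where "x i \<noteq> y i" by blast
  then have *: "x (LEAST k. x k \<noteq> y k) \<noteq> y (LEAST k. x k \<noteq> y k)"
    by (rule LeastI)
  have "seq_dist x y \<le> (1/2) ^ N \<longleftrightarrow> N \<le> (LEAST k. x k \<noteq> y k)"
    using False by (simp add: seq_dist_def power_decreasing_iff)
  also have "\<dots> \<longleftrightarrow> (\<forall>k<N. x k = y k)"
    using * by (metis (mono_tags, lifting) leD not_less_Least leI order_less_le_trans)
  finally show ?thesis .
qed (simp add: seq_dist_def)

text \<open>Nonzero distances are powers of 1/2, so a strict bound gains exactly one coordinate over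
  the non-strict one: coordinate \<open>N\<close> itself is included.\<close>

lemma seq_dist_less_iff_agree: "seq_dist x y < (1/2) ^ N \<longleftrightarrow> (\<forall>k\<le>N. x k = y k)"
proof
  assume less: "seq_dist x y < (1/2) ^ N"
  have "x = y \<or> N < (LEAST k. x k \<noteq> y k)"
  proof (rule ccontr)
    assume "\<not> ?thesis"
    then have "(1/2::real) ^ N \<le> (1/2) ^ (LEAST k. x k \<noteq> y k)" "x \<noteq> y"
      by (auto intro: power_decreasing)
    then show False using less by (simp add: seq_dist_def)
  qed
  then show "\<forall>k\<le>N. x k = y k" using not_less_Least[of _ "\<lambda>k. x k \<noteq> y k"] by (metis order_le_less_trans)
next
  assume "\<forall>k\<le>N. x k = y k"
  then have "seq_dist x y \<le> (1/2) ^ Suc N" by (simp only: seq_dist_le_iff_agree less_Suc_eq_le)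
  also have "\<dots> < (1/2) ^ N" by simp
  finally show "seq_dist x y < (1/2) ^ N" .
qed

lemma sign_seqs_upd: "x \<in> sign_seqs \<Longrightarrow> c \<in> {-1, 1} \<Longrightarrow> x(n := c) \<in> sign_seqs"
  by (auto simp: sign_seqs_def)

lemma half_power_powr: "((1/2) ^ N) powr s = exp (- (real N * (s * ln 2)))"
proof -
  have "(1/2::real) ^ N = exp (- (real N * ln 2))"
    by (simp add: exp_minus exp_of_nat_mult power_one_over inverse_eq_divide)
  then show ?thesis by (simp only: exp_powr_real) (simp add: mult_ac)
qed

text \<open>What both bounds use of the functions \<open>f n\<close>. The product form enters
  through \<open>f_flip\<close>: the factor \<open>g n\<close> does not see coordinate
  \<open>n\<close>. The window in \<open>f_cong\<close> has \<open>L + 1\<close> coordinates,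
  \<open>n\<close> included.\<close>

locale sign_functions =
  fixes f :: "nat \<Rightarrow> (nat \<Rightarrow> real) \<Rightarrow> real" and L :: nat
  assumes f_sign: "x \<in> sign_seqs \<Longrightarrow> f n x \<in> {-1, 1}"
    and f_flip: "x \<in> sign_seqs \<Longrightarrow> f n (x(n := - x n)) = - f n x"
    and f_cong: "\<lbrakk>x \<in> sign_seqs; z \<in> sign_seqs; \<And>k. n \<le> k \<Longrightarrow> k \<le> n + L \<Longrightarrow> x k = z k\<rbrakk>
      \<Longrightarrow> f n x = f n z"
begin

text \<open>Decoding runs backwards: once the coordinates after \<open>n\<close> are known, the sign
  \<open>f n x\<close> leaves one choice for \<open>x n\<close>. The tail of length \<open>L\<close>
  starts the recursion.\<close>

lemma eq_of_f_eq:
  assumes xz: "x \<in> sign_seqs" "z \<in> sign_seqs"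
    and f_eq: "\<And>n. n < N \<Longrightarrow> f n x = f n z"
    and tail: "\<And>k. N \<le> k \<Longrightarrow> k < N + L \<Longrightarrow> x k = z k"
    and "k < N + L"
  shows "x k = z k"
proof -
  \<comment> \<open>\<open>j\<close> counts the coordinates recovered below \<open>N\<close>; at
    \<open>j = N\<close> the lower limit on \<open>k\<close> is void.\<close>
  have "\<forall>k. N - j \<le> k \<and> k < N + L \<longrightarrow> x k = z k" for j
  proof (induction j)
    case 0
    then show ?case using tail by auto
  next
    case (Suc j)
    show ?case
    proof (cases "j < N")
      case True
      define n where "n = N - Suc j"
      have n: "N - j = Suc n" "n < N" using True by (auto simp: n_def)
      have "x n = z n"
      proof (rule ccontr)
        assume ne: "x n \<noteq> z n"
        have signs: "x n \<in> {-1, 1}" "z n \<in> {-1, 1}" using xz by (auto simp: sign_seqs_def)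
        \<comment> \<open>Two different signs are opposite, so flipping \<open>x n\<close> makes
          \<open>x\<close> agree with \<open>z\<close> on the whole window, which ends below
          \<open>N + L\<close>; then \<open>f n x\<close> would be its own negative.\<close>
        have "f n (x(n := - x n)) = f n z"
        proof (rule f_cong)
          show "x(n := - x n) \<in> sign_seqs" using xz signs by (intro sign_seqs_upd) auto
          fix k assume k: "n \<le> k" "k \<le> n + L"
          show "(x(n := - x n)) k = z k"
          proof (cases "k = n")
            case True
            then show ?thesis using ne signs by auto
          next
            case False
            then show ?thesis using Suc.IH n k by auto
          qed
        qed (use xz in auto)
        then have "f n x = - f n x" using f_flip xz(1) f_eq[OF n(2)] by metis
        then show False using f_sign[OF xz(1), of n] by auto
      qed
      then show ?thesis using Suc.IH n unfolding n_def[symmetric]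
        by (metis Suc_leI le_neq_implies_less)
    next
      case False
      then show ?thesis using Suc by auto
    qed
  qed
  from this[of N] \<open>k < N + L\<close> show ?thesis by simp
qed

text \<open>Coordinates are adjusted from \<open>N - 1\<close> down to 0: flipping
  \<open>x n\<close> repairs the sign at \<open>n\<close>, and later signs survive because their
  windows start after \<open>n\<close>.\<close>

lemma finite_prescription:
  assumes y: "y \<in> sign_seqs"
  shows "\<exists>x\<in>sign_seqs. \<forall>n<N. f n x = y n"
proof -
  have "\<exists>x\<in>sign_seqs. \<forall>n. N - j \<le> n \<and> n < N \<longrightarrow> f n x = y n" for j
  proof (induction j)
    case 0
    then show ?case using y by auto
  next
    case (Suc j)
    then obtain x where x: "x \<in> sign_seqs" "\<And>n. N - j \<le> n \<Longrightarrow> n < N \<Longrightarrow> f n x = y n"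
      by blast
    show ?case
    proof (cases "j < N")
      case True
      define n where "n = N - Suc j"
      have n: "N - j = Suc n" using True by (auto simp: n_def)
      define x' where "x' = (if f n x = y n then x else x(n := - x n))"
      have flip: "x(n := - x n) \<in> sign_seqs"
        using x(1) by (intro sign_seqs_upd) (auto simp: sign_seqs_def)
      then have x': "x' \<in> sign_seqs" using x(1) by (auto simp: x'_def)
      moreover have "f n x' = y n"
      proof (cases "f n x = y n")
        case False
        then show ?thesis using f_flip[OF x(1)] f_sign[OF x(1), of n] y
          by (auto simp: x'_def sign_seqs_def dest!: spec[of _ n])
      qed (simp add: x'_def)
      moreover have "f i x' = y i" if "N - j \<le> i" "i < N" for i
      proof -
        have "f i x' = f i x" using x' x(1) n that by (intro f_cong) (auto simp: x'_def)
        then show ?thesis using x(2) that by simp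
      qed
      ultimately show ?thesis using n unfolding n_def[symmetric]
        by (metis Suc_leI le_neq_implies_less)
    next
      case False
      then show ?thesis using x by auto
    qed
  qed
  from this[of N] show ?thesis by simp
qed

text \<open>Solutions of the first \<open>N\<close> equations accumulate, by compactness, at a
  sequence that satisfies all of them, since each equation involves finitely many
  coordinates.\<close>

lemma prescription:
  assumes y: "y \<in> sign_seqs"
  shows "\<exists>x\<in>sign_seqs. \<forall>n. f n x = y n"
proof -
  have "\<forall>N. \<exists>x\<in>sign_seqs. \<forall>n<N. f n x = y n" using finite_prescription[OF y] by blast
  then obtain X where X: "\<And>N. X N \<in> sign_seqs" "\<And>N n. n < N \<Longrightarrow> f n (X N) = y n"
    by metis
  have "sign_seqs = PiE UNIV (\<lambda>_. {-1, 1::real})"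
    by (auto simp: sign_seqs_def)
  then have "compact sign_seqs"
    using compactin_PiE[of "\<lambda>_. euclideanreal" "UNIV :: nat set" "\<lambda>_. {-1, 1::real}"]
    by (simp add: euclidean_product_topology)
  then have "seq_compact sign_seqs" by (simp add: compact_eq_seq_compact_metric)
  then obtain x r where x: "x \<in> sign_seqs" and r: "strict_mono r" and lim: "(X \<circ> r) \<longlonglongrightarrow> x"
    using X(1) unfolding seq_compact_def by metis
  have agree: "\<forall>\<^sub>F i in sequentially. X (r i) k = x k" for k
  proof -
    have "(\<lambda>i. (X \<circ> r) i k) \<longlonglongrightarrow> x k"
      using continuous_on_tendsto_compose[OF continuous_on_product_coordinates lim] by simp
    \<comment> \<open>Distinct signs are at distance 2, so closeness within 1 already means
      equality.\<close>
    then have "\<forall>\<^sub>F i in sequentially. dist (X (r i) k) (x k) < 1"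
      by (auto dest: tendstoD[where e = 1])
    then show ?thesis
    proof (rule eventually_mono)
      fix i assume "dist (X (r i) k) (x k) < 1"
      moreover have "X (r i) k \<in> {-1, 1}" "x k \<in> {-1, 1}" using X(1) x by (auto simp: sign_seqs_def)
      ultimately show "X (r i) k = x k" by (auto simp: dist_real_def)
    qed
  qed
  have "f n x = y n" for n
  proof -
    have "\<forall>\<^sub>F i in sequentially. \<forall>k\<in>{n..n+L}. X (r i) k = x k"
      using agree by (intro eventually_ball_finite) auto
    moreover have "\<forall>\<^sub>F i in sequentially. n < r i"
      by (rule eventually_compose_filterlim[OF eventually_gt_at_top filterlim_subseq[OF r]])
    ultimately have "\<forall>\<^sub>F i in sequentially. f n x = y n"
    proof eventually_elim
      case (elim i)
      then have "f n x = f n (X (r i))" using x X(1) by (intro f_cong) auto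
      with elim X(2) show ?case by simp
    qed
    then show ?thesis by simp
  qed
  with x show ?thesis by blast
qed

end

section \<open>Averages over the values and the equation for \<open>\<lambda>\<close>\<close>

lemma average_over_values:
  fixes w v p :: "nat \<Rightarrow> real" and h :: "real \<Rightarrow> real"
  assumes inj: "inj_on v {..m}" and range: "range w = v ` {..m}"
    and freq: "\<And>j. j \<le> m \<Longrightarrow>
           (\<lambda>N. real (card {n \<in> {1..N}. w n = v j}) / real N) \<longlonglongrightarrow> p j"
  shows "(\<lambda>N. (\<Sum>n<N. h (w n)) / real N) \<longlonglongrightarrow> (\<Sum>j\<le>m. p j * h (v j))"
proof -
  \<comment> \<open>Injectivity of \<open>v\<close> makes exactly one summand survive, so the terms
    can be grouped by value.\<close>
  have hw: "h (w n) = (\<Sum>j\<le>m. if w n = v j then h (v j) else 0)" for n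
  proof -
    obtain i where i: "i \<le> m" "w n = v i" using range by (metis atMost_iff imageE rangeI)
    have "(\<Sum>j\<le>m. if w n = v j then h (v j) else 0) = (\<Sum>j\<le>m. if j = i then h (v i) else 0)"
      using i inj by (intro sum.cong) (auto simp: inj_on_def)
    then show ?thesis using i by simp
  qed
  have sum1: "(\<Sum>n\<in>{1..N}. h (w n)) = (\<Sum>j\<le>m. card {n \<in> {1..N}. w n = v j} * h (v j))" for N
    by (subst hw, subst sum.swap) (simp add: sum.If_cases Int_def)
  have "(\<lambda>N. (\<Sum>j\<le>m. card {n \<in> {1..N}. w n = v j} / real N * h (v j)))
      \<longlonglongrightarrow> (\<Sum>j\<le>m. p j * h (v j))"
    by (intro tendsto_intros freq) auto
  then have lim1: "(\<lambda>N. (\<Sum>n\<in>{1..N}. h (w n)) / real N) \<longlonglongrightarrow> (\<Sum>j\<le>m. p j * h (v j))"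
    unfolding sum1 by (simp add: sum_divide_distrib)
  have "finite (range w)" using range by simp
  then have "finite ((\<lambda>n. h (w n)) ` UNIV)"
    by (metis finite_imageI image_image)
  then have "bounded (range (\<lambda>n. h (w n)))" by (rule finite_imp_bounded)
  then obtain B where B: "\<And>n. \<bar>h (w n)\<bar> \<le> B"
    by (auto simp: bounded_iff)
  \<comment> \<open>The frequencies count from 1 to \<open>N\<close>, the averages from 0 to
    \<open>N - 1\<close>; the two sums differ by this boundary term, which is bounded because
    \<open>w\<close> has finitely many values.\<close>
  have "(\<lambda>N. (h (w 0) - h (w N)) / real N) \<longlonglongrightarrow> 0"
  proof (rule Lim_null_comparison)
    show "\<forall>\<^sub>F N in sequentially. norm ((h (w 0) - h (w N)) / real N) \<le> 2 * B / real N"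
    proof (intro always_eventually allI)
      fix N
      have "\<bar>h (w 0) - h (w N)\<bar> \<le> 2 * B" using B[of 0] B[of N] by linarith
      then show "norm ((h (w 0) - h (w N)) / real N) \<le> 2 * B / real N"
        by (simp add: divide_right_mono)
    qed
    show "(\<lambda>N. 2 * B / real N) \<longlonglongrightarrow> 0" by real_asymp
  qed
  from tendsto_add[OF lim1 this]
  have "(\<lambda>N. (\<Sum>n\<in>{1..N}. h (w n)) / real N + (h (w 0) - h (w N)) / real N)
      \<longlonglongrightarrow> (\<Sum>j\<le>m. p j * h (v j))" by simp
  moreover have "(\<Sum>n\<in>{1..N}. h (w n)) + (h (w 0) - h (w N)) = (\<Sum>n<N. h (w n))" for N
    by (induction N) auto
  ultimately show ?thesis by (simp add: add_divide_distrib[symmetric])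
qed

text \<open>The left side is odd and strictly increasing in \<open>l\<close>, with limit
  \<open>\<Sum>j\<le>m. p j * \<bar>v j\<bar>\<close> at infinity. Monotonicity gives uniqueness,
  the intermediate value theorem existence.\<close>

lemma weighted_tanh_eq_unique:
  fixes v p :: "nat \<Rightarrow> real"
  assumes p: "\<And>j. j \<le> m \<Longrightarrow> 0 \<le> p j"
    and \<alpha>: "- (\<Sum>j\<le>m. p j * \<bar>v j\<bar>) < \<alpha>" "\<alpha> < (\<Sum>j\<le>m. p j * \<bar>v j\<bar>)"
  shows "\<exists>!l. (\<Sum>j\<le>m. p j * v j * tanh (l * v j)) = \<alpha>"
proof -
  define \<phi> where "\<phi> l = (\<Sum>j\<le>m. p j * v j * tanh (l * v j))" for l
  \<comment> \<open>Otherwise the interval for \<alpha> would be empty. This index makes the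
    monotonicity strict.\<close>
  have "\<exists>j\<le>m. 0 < p j \<and> v j \<noteq> 0"
  proof (rule ccontr)
    assume "\<not> ?thesis"
    then have "(\<Sum>j\<le>m. p j * \<bar>v j\<bar>) = 0" using p by (intro sum.neutral) force
    with \<alpha> show False by simp
  qed
  then obtain j0 where j0: "j0 \<le> m" "0 < p j0" "v j0 \<noteq> 0" by blast
  have strict: "v j * tanh (a * v j) < v j * tanh (b * v j)" if "a < b" "v j \<noteq> 0" for a b j
    using that by (cases "v j > 0") (auto simp: mult_less_cancel_left)
  have mono: "\<phi> a < \<phi> b" if "a < b" for a b
    unfolding \<phi>_def
  proof (rule sum_strict_mono_ex1)
    show "\<forall>j\<in>{..m}. p j * v j * tanh (a * v j) \<le> p j * v j * tanh (b * v j)"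
    proof
      fix j assume "j \<in> {..m}"
      then show "p j * v j * tanh (a * v j) \<le> p j * v j * tanh (b * v j)"
        using mult_left_mono[OF less_imp_le[OF strict[OF that, of j]], of "p j"] p[of j]
        by (cases "v j = 0") (simp_all add: mult.assoc)
    qed
    show "\<exists>j\<in>{..m}. p j * v j * tanh (a * v j) < p j * v j * tanh (b * v j)"
      using j0 strict[OF that j0(3)] by (auto simp: mult.assoc intro!: bexI[of _ j0])
  qed simp
  have lim: "((\<lambda>l. v j * tanh (l * v j)) \<longlongrightarrow> \<bar>v j\<bar>) at_top" for j
  proof -
    consider "v j > 0" | "v j = 0" | "v j < 0" by linarith
    then show ?thesis
    proof cases
      case 1
      then have "filterlim (\<lambda>l. l * v j) at_top at_top" by real_asymp
      from tendsto_mult_left[OF filterlim_compose[OF tanh_real_at_top this], of "v j"] 1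
      show ?thesis by simp
    next
      case 3
      then have "filterlim (\<lambda>l. l * v j) at_bot at_top" by real_asymp
      from tendsto_mult_left[OF filterlim_compose[OF tanh_real_at_bot this], of "v j"] 3
      show ?thesis by simp
    qed simp
  qed
  have "(\<phi> \<longlongrightarrow> (\<Sum>j\<le>m. p j * \<bar>v j\<bar>)) at_top"
    unfolding \<phi>_def mult.assoc by (intro tendsto_intros lim)
  then have ev: "\<forall>\<^sub>F l in at_top. c < \<phi> l" if "c < (\<Sum>j\<le>m. p j * \<bar>v j\<bar>)" for c
    using that by (rule order_tendstoD)
  from ev[OF \<alpha>(2)] ev[of "-\<alpha>"] \<alpha>(1)
  have "\<forall>\<^sub>F l in at_top. \<alpha> < \<phi> l \<and> -\<alpha> < \<phi> l \<and> 0 \<le> l"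
    by (intro eventually_conj eventually_ge_at_top) auto
  then obtain b where b: "\<alpha> < \<phi> b" "-\<alpha> < \<phi> b" "0 \<le> b"
    by (auto simp: eventually_at_top_linorder)
  \<comment> \<open>Oddness provides the left endpoint, which is why \<open>\<phi> b\<close> was
    made larger than both \<alpha> and -\<alpha>.\<close>
  have "\<phi> (-b) = - \<phi> b" by (simp add: \<phi>_def sum_negf)
  moreover have "continuous_on {-b..b} \<phi>"
    unfolding \<phi>_def by (intro continuous_intros) auto
  ultimately obtain l where "\<phi> l = \<alpha>"
    using IVT'[of \<phi> "-b" \<alpha> b] b by auto
  then show ?thesis
    using mono unfolding \<phi>_def[symmetric] by (metis linorder_less_linear less_irrefl)
qed

section \<open>The upper bound\<close>

lemma set_diam_le_agree:
  assumes "\<And>x y k. x \<in> U \<Longrightarrow> y \<in> U \<Longrightarrow> k < N \<Longrightarrow> x k = y k"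
  shows "set_diam seq_dist U \<le> ennreal ((1/2) ^ N)"
  unfolding set_diam_def using assms
  by (intro SUP_least ennreal_leI) (simp add: seq_dist_le_iff_agree)

text \<open>\<open>0 < r\<close> matters at \<open>s = 0\<close>: there a nonempty set contributes
  1, and \<open>r powr 0\<close> equals 1 only for nonzero \<open>r\<close>.\<close>

lemma diam_pow_le_powr:
  assumes "set_diam d U \<le> ennreal r" "0 < r" "0 \<le> s"
  shows "diam_pow d s U \<le> ennreal (r powr s)"
proof -
  have "enn2real (set_diam d U) \<le> r"
    using assms by (simp add: enn2real_leI)
  then show ?thesis using assms by (auto simp: diam_pow_def intro!: ennreal_leI powr_mono2)
qed

text \<open>Each finite family is enumerated and padded with empty sets, which contribute 0; the
  pairing bijection then merges all of them into one sequence.\<close>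

lemma hausdorff_premeasure_le_suminf:
  fixes V :: "nat \<Rightarrow> 'b \<Rightarrow> 'a set"
  assumes cover: "E \<subseteq> (\<Union>N. \<Union>c\<in>W N. V N c)"
    and fin: "\<And>N. finite (W N)"
    and V: "\<And>N c. c \<in> W N \<Longrightarrow> V N c \<subseteq> M \<and> set_diam d (V N c) \<le> ennreal \<delta>"
  shows "hausdorff_premeasure M d s \<delta> E \<le> (\<Sum>N. \<Sum>c\<in>W N. diam_pow d s (V N c))"
proof -
  have "\<exists>h. bij_betw h {..<card (W N)} (W N)" for N
    using ex_bij_betw_nat_finite[OF fin[of N]] by (simp add: atLeast0LessThan)
  then obtain h where h: "\<And>N. bij_betw (h N) {..<card (W N)} (W N)" by metis
  define V' where "V' = (\<lambda>(N, i). if i < card (W N) then V N (h N i) else {})"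
  define U where "U = (\<lambda>k. V' (prod_decode k))"
  have "(\<Sum>i. diam_pow d s (V' (N, i))) = (\<Sum>c\<in>W N. diam_pow d s (V N c))" for N
  proof -
    have "(\<Sum>i. diam_pow d s (V' (N, i))) = (\<Sum>i<card (W N). diam_pow d s (V' (N, i)))"
      by (rule suminf_finite) (auto simp: V'_def diam_pow_def)
    also have "\<dots> = (\<Sum>i<card (W N). diam_pow d s (V N (h N i)))"
      by (simp add: V'_def)
    also have "\<dots> = (\<Sum>c\<in>W N. diam_pow d s (V N c))"
      using h by (rule sum.reindex_bij_betw)
    finally show ?thesis .
  qed
  then have "(\<Sum>k. diam_pow d s (U k)) = (\<Sum>N. \<Sum>c\<in>W N. diam_pow d s (V N c))"
    unfolding U_def
    by (subst suminf_ennreal_2dimen[where f = "\<lambda>x. diam_pow d s (V' x)", OF refl]) simp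
  moreover have "E \<subseteq> (\<Union>k. U k)"
  proof
    fix x assume "x \<in> E"
    then obtain N c where c: "c \<in> W N" "x \<in> V N c" using cover by blast
    then obtain i where "i < card (W N)" "c = h N i"
      using h[of N] by (auto simp: bij_betw_def)
    with c have "x \<in> U (prod_encode (N, i))" by (simp add: U_def V'_def)
    then show "x \<in> (\<Union>k. U k)" by blast
  qed
  moreover have "V' (N, i) \<subseteq> M \<and> set_diam d (V' (N, i)) \<le> ennreal \<delta>" for N i
  proof (cases "i < card (W N)")
    case True
    then have "h N i \<in> W N" using h[of N] by (auto simp: bij_betw_def)
    with True V show ?thesis by (simp add: V'_def)
  qed (simp add: V'_def set_diam_def bot_ennreal)
  then have "U k \<subseteq> M \<and> set_diam d (U k) \<le> ennreal \<delta>" for k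
    unfolding U_def by (cases "prod_decode k") simp
  ultimately show ?thesis unfolding hausdorff_premeasure_def
    by (intro Inf_lower CollectI exI[of _ U]) auto
qed

text \<open>Each word in \<open>G\<close> has weight \<open>exp (l * (\<Sum>n<N. w n * y n))\<close>
  at least \<open>exp a\<close>, and the weights of all words add up to the product of the factors
  \<open>2 * cosh (l * w n)\<close>.\<close>

lemma card_sign_words_le:
  fixes w :: "nat \<Rightarrow> real"
  defines "Y \<equiv> (\<lambda>N. {..<N} \<rightarrow>\<^sub>E {-1, 1::real})"
  assumes "\<And>y. y \<in> G \<Longrightarrow> a \<le> l * (\<Sum>n<N. w n * y n)" and "G \<subseteq> Y N"
  shows "real (card G) \<le> exp ((\<Sum>n<N. ln (2 * cosh (l * w n))) - a)"
proof -
  have fin: "finite (Y N)" unfolding Y_def by (intro finite_PiE) auto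
  have "real (card G) * exp a = (\<Sum>y\<in>G. exp a)" by simp
  also have "\<dots> \<le> (\<Sum>y\<in>G. \<Prod>n<N. exp (l * (w n * y n)))"
    using assms(2) by (intro sum_mono) (simp add: exp_sum[symmetric] sum_distrib_left)
  also have "\<dots> \<le> (\<Sum>y\<in>Y N. \<Prod>n<N. exp (l * (w n * y n)))"
    using fin assms(3) by (intro sum_mono2 prod_nonneg) auto
  also have "\<dots> = (\<Prod>n<N. \<Sum>c\<in>{-1, 1}. exp (l * (w n * c)))"
    unfolding Y_def by (rule prod_sum_PiE[symmetric]) auto
  also have "\<dots> = (\<Prod>n<N. 2 * cosh (l * w n))"
    by (intro prod.cong) (auto simp: cosh_def)
  also have "\<dots> = exp (\<Sum>n<N. ln (2 * cosh (l * w n)))"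
    by (simp add: exp_sum)
  finally show ?thesis by (simp add: exp_diff field_simps)
qed

context sign_functions
begin

text \<open>Covers at all scales beyond \<open>N\<^sub>0\<close> together are a cover of the level set, so no
  decomposition of the level set into countably many uniform pieces is needed.\<close>

lemma hausdorff_measure_level_set_eq_0:
  assumes lnc: "(\<lambda>N. (\<Sum>n<N. ln (2 * cosh (l * w n))) / real N) \<longlonglongrightarrow> P"
    and s: "0 \<le> s" "P - l * \<alpha> < s * ln 2"
  shows "hausdorff_measure sign_seqs seq_dist s (level_set w f \<alpha>) = 0"
proof -
  \<comment> \<open>\<open>\<kappa>\<close> is half of the gap
    \<open>s * ln 2 - (P - l * \<alpha>)\<close>: errors use up one half, the other makes the sums
    decay like \<open>exp (- \<kappa>) ^ N\<close>. The errors are \<open>\<eta>\<close> from the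
    mean of the logarithms and \<open>\<bar>l\<bar> * \<eta>\<close> from the deviation from
    \<alpha>; together they equal \<open>\<kappa>\<close>, also for \<open>l = 0\<close>.\<close>
  define \<kappa> where "\<kappa> = (s * ln 2 - (P - l * \<alpha>)) / 2"
  define \<eta> where "\<eta> = \<kappa> / (1 + \<bar>l\<bar>)"
  have \<kappa>: "0 < \<kappa>" and \<eta>: "0 < \<eta>" using s by (auto simp: \<kappa>_def \<eta>_def add_pos_nonneg)
  have "1 + \<bar>l\<bar> \<noteq> 0" by linarith
  then have "(1 + \<bar>l\<bar>) * \<eta> = \<kappa>" by (simp add: \<eta>_def)
  then have \<eta>\<kappa>: "\<eta> + \<bar>l\<bar> * \<eta> = \<kappa>" by (simp add: distrib_right)
  define G where "G N = {y \<in> {..<N} \<rightarrow>\<^sub>E {-1, 1::real}.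
      \<bar>(\<Sum>n<N. w n * y n) - real N * \<alpha>\<bar> \<le> real N * \<eta>}" for N
  \<comment> \<open>Prescribing \<open>L\<close> coordinates besides the signs pins down all
    coordinates below \<open>N + L\<close>, so the diameter is at most \<open>(1/2) ^ N\<close>; the
    number of pieces only grows by the factor \<open>2 ^ L\<close>.\<close>
  define V where "V N = (\<lambda>(y, u). {x \<in> sign_seqs.
      (\<forall>n<N. f n x = y n) \<and> (\<forall>k<L. x (N + k) = u k)})"
    for N :: nat and y u :: "nat \<Rightarrow> real"
  define T where "T = ({..<L} \<rightarrow>\<^sub>E {-1, 1::real})"
  have finT: "finite T" and cardT: "card T = 2 ^ L"
    unfolding T_def by (auto intro: finite_PiE simp: card_PiE numeral_2_eq_2)
  have finG: "finite (G N)" for N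
    unfolding G_def by (auto intro!: finite_PiE)
  have diamV: "set_diam seq_dist (V N c) \<le> ennreal ((1/2) ^ N)" for N c
  proof (rule set_diam_le_agree)
    fix x z k assume xz: "x \<in> V N c" "z \<in> V N c" and "k < N"
    show "x k = z k"
    proof (rule eq_of_f_eq)
      fix i assume "N \<le> i" "i < N + L"
      then obtain j where "i = N + j" "j < L" by (metis le_iff_add nat_add_left_cancel_less)
      then show "x i = z i" using xz by (auto simp: V_def split: prod.splits)
    qed (use xz \<open>k < N\<close> in \<open>auto simp: V_def split: prod.splits\<close>)
  qed
  obtain N1 where N1: "\<And>N. N1 \<le> N \<Longrightarrow> (\<Sum>n<N. ln (2 * cosh (l * w n))) \<le> real N * (P + \<eta>)"
  proof -
    have "\<forall>\<^sub>F N in sequentially. (\<Sum>n<N. ln (2 * cosh (l * w n))) / real N < P + \<eta>"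
      using \<eta> by (intro order_tendstoD[OF lnc]) auto
    then have "\<forall>\<^sub>F N in sequentially. (\<Sum>n<N. ln (2 * cosh (l * w n))) \<le> real N * (P + \<eta>)"
      using eventually_gt_at_top[of 0] by eventually_elim (simp add: field_simps)
    then show ?thesis using that by (auto simp: eventually_sequentially)
  qed
  have sum_le: "(\<Sum>c\<in>G N \<times> T. diam_pow seq_dist s (V N c)) \<le> ennreal (2 ^ L * exp (- \<kappa>) ^ N)"
    if "N1 \<le> N" for N
  proof -
    have "real (card (G N)) \<le> exp ((\<Sum>n<N. ln (2 * cosh (l * w n))) - real N * (l * \<alpha> - \<bar>l\<bar> * \<eta>))"
    proof (rule card_sign_words_le)
      fix y assume "y \<in> G N"
      \<comment> \<open>Multiplying by \<open>\<bar>l\<bar>\<close> gives a lower bound valid for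
        either sign of \<open>l\<close>.\<close>
      then have "\<bar>l\<bar> * \<bar>(\<Sum>n<N. w n * y n) - real N * \<alpha>\<bar> \<le> \<bar>l\<bar> * (real N * \<eta>)"
        by (intro mult_left_mono) (auto simp: G_def)
      then have "\<bar>l * (\<Sum>n<N. w n * y n) - l * (real N * \<alpha>)\<bar> \<le> \<bar>l\<bar> * (real N * \<eta>)"
        by (simp add: abs_mult[symmetric] right_diff_distrib)
      then show "real N * (l * \<alpha> - \<bar>l\<bar> * \<eta>) \<le> l * (\<Sum>n<N. w n * y n)"
        by (simp add: algebra_simps abs_le_iff)
    qed (auto simp: G_def)
    also have "\<dots> \<le> exp (real N * (P + \<eta>) - real N * (l * \<alpha> - \<bar>l\<bar> * \<eta>))"
      using N1[OF that] by simp
    also have "real N * (P + \<eta>) - real N * (l * \<alpha> - \<bar>l\<bar> * \<eta>) = real N * (P - l * \<alpha> + \<kappa>)"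
      unfolding \<eta>\<kappa>[symmetric] by (simp add: algebra_simps)
    finally have card: "real (card (G N)) \<le> exp (real N * (P - l * \<alpha> + \<kappa>))" .
    have "(\<Sum>c\<in>G N \<times> T. diam_pow seq_dist s (V N c))
        \<le> (\<Sum>c\<in>G N \<times> T. ennreal (exp (- (real N * (s * ln 2)))))"
      using diam_pow_le_powr[OF diamV _ s(1)] unfolding half_power_powr by (intro sum_mono) simp
    also have "\<dots> = ennreal (real (card (G N)) * 2 ^ L * exp (- (real N * (s * ln 2))))"
      by (simp add: card_cartesian_product cardT ennreal_mult ennreal_of_nat_eq_real_of_nat)
    also have "\<dots> \<le> ennreal (exp (real N * (P - l * \<alpha> + \<kappa>)) * 2 ^ L * exp (- (real N * (s * ln 2))))"
      using card by (intro ennreal_leI mult_right_mono) auto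
    also have "exp (real N * (P - l * \<alpha> + \<kappa>)) * 2 ^ L * exp (- (real N * (s * ln 2)))
        = 2 ^ L * exp (real N * (P - l * \<alpha> + \<kappa> - s * ln 2))"
      by (simp add: exp_add[symmetric] algebra_simps)
    also have "P - l * \<alpha> + \<kappa> - s * ln 2 = - \<kappa>" by (simp add: \<kappa>_def field_simps)
    also have "exp (real N * - \<kappa>) = exp (- \<kappa>) ^ N" by (simp only: exp_of_nat_mult)
    finally show ?thesis .
  qed
  have premeasure: "hausdorff_premeasure sign_seqs seq_dist s \<delta> (level_set w f \<alpha>)
      \<le> ennreal (2 ^ L * exp (- \<kappa>) ^ N0 / (1 - exp (- \<kappa>)))"
    if N0: "N1 \<le> N0" "0 < N0" "(1/2) ^ N0 \<le> \<delta>" for N0 \<delta>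
  proof -
    \<comment> \<open>Scales below \<open>N0\<close> are dropped, so that every piece has diameter
      at most \<open>\<delta>\<close>; a point of the level set is caught at all large
      \<open>N\<close>, and one \<open>N \<ge> N0\<close> suffices.\<close>
    define W where "W N = (if N < N0 then {} else G N \<times> T)" for N
    have "level_set w f \<alpha> \<subseteq> (\<Union>N. \<Union>c\<in>W N. V N c)"
    proof
      fix x assume x: "x \<in> level_set w f \<alpha>"
      then have xs: "x \<in> sign_seqs" by (simp add: level_set_def)
      have "(\<lambda>N. (\<Sum>n<N. w n * f n x) / real N) \<longlonglongrightarrow> \<alpha>"
        using x by (simp add: level_set_def)
      then have "\<forall>\<^sub>F N in sequentially. dist ((\<Sum>n<N. w n * f n x) / real N) \<alpha> < \<eta>"
        using \<eta> by (rule tendstoD)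
      then have "\<forall>\<^sub>F N in sequentially. N0 \<le> N \<and> dist ((\<Sum>n<N. w n * f n x) / real N) \<alpha> < \<eta>"
        by (intro eventually_conj eventually_ge_at_top)
      then obtain N where N: "N0 \<le> N" "\<bar>(\<Sum>n<N. w n * f n x) / real N - \<alpha>\<bar> < \<eta>"
        by (auto simp: eventually_sequentially dist_real_def)
      then have "real N * \<bar>(\<Sum>n<N. w n * f n x) / real N - \<alpha>\<bar> \<le> real N * \<eta>"
        by (intro mult_left_mono) auto
      also have "real N * \<bar>(\<Sum>n<N. w n * f n x) / real N - \<alpha>\<bar>
          = \<bar>real N * ((\<Sum>n<N. w n * f n x) / real N - \<alpha>)\<bar>" by (simp add: abs_mult)
      also have "real N * ((\<Sum>n<N. w n * f n x) / real N - \<alpha>)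
          = (\<Sum>n<N. w n * f n x) - real N * \<alpha>"
        using N N0 by (simp add: field_simps)
      finally have "restrict (\<lambda>n. f n x) {..<N} \<in> G N"
        using f_sign[OF xs] by (auto simp: G_def)
      moreover have "restrict (\<lambda>k. x (N + k)) {..<L} \<in> T"
        using xs by (auto simp: T_def sign_seqs_def)
      ultimately show "x \<in> (\<Union>N. \<Union>c\<in>W N. V N c)" using N(1) xs
        by (intro UN_I[of N] UN_I[of "(restrict (\<lambda>n. f n x) {..<N}, restrict (\<lambda>k. x (N + k)) {..<L})"])
          (auto simp: W_def V_def)
    qed
    moreover have "set_diam seq_dist (V N c) \<le> ennreal \<delta>" if "c \<in> W N" for N c
    proof -
      have "N0 \<le> N" using that by (auto simp: W_def split: if_splits)
      then have "(1/2::real) ^ N \<le> (1/2) ^ N0" by (intro power_decreasing) auto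
      then show ?thesis using N0(3) by (intro order_trans[OF diamV] ennreal_leI) (rule order_trans)
    qed
    ultimately have "hausdorff_premeasure sign_seqs seq_dist s \<delta> (level_set w f \<alpha>)
        \<le> (\<Sum>N. \<Sum>c\<in>W N. diam_pow seq_dist s (V N c))"
      using finG finT by (intro hausdorff_premeasure_le_suminf) (auto simp: W_def V_def)
    also have "\<dots> = (\<Sum>N. \<Sum>c\<in>W (N + N0). diam_pow seq_dist s (V (N + N0) c))"
      by (subst suminf_offset[of _ N0]) (simp_all add: W_def)
    also have "\<dots> \<le> (\<Sum>N. ennreal (2 ^ L * exp (- \<kappa>) ^ (N + N0)))"
      using sum_le N0(1) by (intro suminf_le) (auto simp: W_def)
    also have "\<dots> = ennreal (2 ^ L * exp (- \<kappa>) ^ N0 / (1 - exp (- \<kappa>)))"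
    proof (rule suminf_ennreal_eq)
      have "(\<lambda>N. exp (- \<kappa>) ^ N) sums (1 / (1 - exp (- \<kappa>)))"
        using \<kappa> by (intro geometric_sums) simp
      from sums_mult[OF this, of "2 ^ L * exp (- \<kappa>) ^ N0"]
      show "(\<lambda>N. 2 ^ L * exp (- \<kappa>) ^ (N + N0)) sums (2 ^ L * exp (- \<kappa>) ^ N0 / (1 - exp (- \<kappa>)))"
        by (simp add: power_add mult_ac)
    qed simp
    finally show ?thesis .
  qed
  \<comment> \<open>For fixed \<open>\<delta>\<close> the starting scale tends to infinity; the
    bound is the tail of a convergent geometric series.\<close>
  have "hausdorff_premeasure sign_seqs seq_dist s \<delta> (level_set w f \<alpha>) \<le> 0"
    if \<delta>: "0 < \<delta>" for \<delta>
  proof (rule tendsto_lowerbound)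
    have "(\<lambda>N. 2 ^ L * exp (- \<kappa>) ^ N / (1 - exp (- \<kappa>))) \<longlonglongrightarrow> 2 ^ L * 0 / (1 - exp (- \<kappa>))"
      using \<kappa> by (intro tendsto_intros LIMSEQ_power_zero) auto
    then show "(\<lambda>N. ennreal (2 ^ L * exp (- \<kappa>) ^ N / (1 - exp (- \<kappa>)))) \<longlonglongrightarrow> 0"
      using tendsto_ennrealI by (metis ennreal_0 mult_zero_right div_0)
    have "(\<lambda>N. (1/2::real) ^ N) \<longlonglongrightarrow> 0" by (intro LIMSEQ_power_zero) auto
    then have "\<forall>\<^sub>F N in sequentially. (1/2) ^ N < \<delta>" using \<delta> by (rule order_tendstoD)
    then show "\<forall>\<^sub>F N in sequentially. hausdorff_premeasure sign_seqs seq_dist s \<delta> (level_set w f \<alpha>)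
        \<le> ennreal (2 ^ L * exp (- \<kappa>) ^ N / (1 - exp (- \<kappa>)))"
      using eventually_ge_at_top[of N1] eventually_gt_at_top[of 0]
      by eventually_elim (rule premeasure, assumption, assumption, erule less_imp_le)
  qed simp
  then show ?thesis unfolding hausdorff_measure_def
    by (intro antisym SUP_least) auto
qed

end

section \<open>The lower bound\<close>

text \<open>Mass distribution principle for a measure living on a parameter space. Preimages of
  cylinders under \<open>T\<close> are enclosed in measurable sets, so that \<open>T\<close> may be
  an arbitrary choice function.\<close>

lemma (in finite_measure) mass_distribution_seq_dist:
  fixes T :: "'a \<Rightarrow> nat \<Rightarrow> 'b"
  assumes A: "A \<in> sets M" "emeasure M A \<noteq> 0"
    and TA: "T ` A \<subseteq> E"
    and "0 \<le> s" "0 < C"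
    and cyl: "\<And>\<omega> k. \<omega> \<in> A \<Longrightarrow> k0 \<le> k \<Longrightarrow>
      \<exists>B\<in>sets M. {\<omega>'\<in>A. \<forall>i<k. T \<omega>' i = T \<omega> i} \<subseteq> B \<and> emeasure M B \<le> ennreal (C * ((1/2) ^ k) powr s)"
  shows "hausdorff_measure X seq_dist s E \<noteq> 0"
proof
  assume zero: "hausdorff_measure X seq_dist s E = 0"
  \<comment> \<open>A cover of total below \<open>c\<close> would force the mass of \<open>A\<close>
    below \<open>C * c\<close>, which is that mass.\<close>
  define c where "c = measure M A / C"
  have c: "0 < c" using A(2) \<open>0 < C\<close>
    by (simp add: c_def measure_nonneg emeasure_eq_measure less_le)
  have "hausdorff_premeasure X seq_dist s ((1/2) ^ k0) E \<le> 0"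
    unfolding zero[symmetric] hausdorff_measure_def by (rule SUP_upper) simp
  also have "0 < ennreal c" using c by simp
  finally obtain U where U: "E \<subseteq> (\<Union>i. U i)" "\<And>i. set_diam seq_dist (U i) \<le> ennreal ((1/2) ^ k0)"
    and small: "(\<Sum>i. diam_pow seq_dist s (U i)) < ennreal c"
    unfolding hausdorff_premeasure_def Inf_less_iff by blast
  have "\<exists>B\<in>sets M. {\<omega>\<in>A. T \<omega> \<in> U i} \<subseteq> B \<and> emeasure M B \<le> ennreal C * diam_pow seq_dist s (U i)" for i
  proof (cases "\<exists>\<omega>\<in>A. T \<omega> \<in> U i")
    case True
    then obtain \<omega> where \<omega>: "\<omega> \<in> A" "T \<omega> \<in> U i" by blast
    define r where "r = enn2real (set_diam seq_dist (U i))"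
    have diam: "set_diam seq_dist (U i) = ennreal r"
      using U(2)[of i] by (simp add: r_def ennreal_enn2real order_le_less_trans less_top)
    have r: "0 \<le> r" "r \<le> (1/2) ^ k0"
      using U(2)[of i] by (simp_all add: r_def enn2real_leI)
    have dist: "seq_dist (T \<omega>') (T \<omega>) \<le> r" if "T \<omega>' \<in> U i" for \<omega>'
    proof -
      have "ennreal (seq_dist (T \<omega>') (T \<omega>)) \<le> set_diam seq_dist (U i)"
        unfolding set_diam_def using that \<omega>(2) by (intro SUP_upper2[of "T \<omega>'"] SUP_upper2[of "T \<omega>"]) auto
      then show ?thesis using r(1) by (simp add: diam ennreal_le_iff)
    qed
    have "U i \<noteq> {}" using \<omega> by auto
    then have diam_pow: "diam_pow seq_dist s (U i) = (if s = 0 then 1 else ennreal (r powr s))"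
      by (simp add: diam_pow_def r_def)
    show ?thesis
    proof (cases "r = 0")
      case False
      \<comment> \<open>Distances at most \<open>r\<close> are below \<open>(1/2) ^ j\<close> for
        every \<open>j < k\<close> and force agreement on the first \<open>k\<close> coordinates,
        while \<open>(1/2) ^ k \<le> r\<close> bounds the cylinder mass by
        \<open>C * r powr s\<close>.\<close>
      define k where "k = (LEAST k. (1/2) ^ k \<le> r)"
      have "\<exists>k. (1/2) ^ k < r" using False r(1) by (intro real_arch_pow_inv) auto
      then have k: "(1/2) ^ k \<le> r" unfolding k_def by (metis (mono_tags, lifting) LeastI less_imp_le)
      have least: "r < (1/2) ^ j" if "j < k" for j
        using not_less_Least[OF that[unfolded k_def]] by simp
      have "k0 \<le> k"
      proof (rule ccontr)
        assume "\<not> k0 \<le> k"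
        then have "(1/2::real) ^ k0 < (1/2) ^ k" by (intro power_strict_decreasing) auto
        with k r(2) show False by linarith
      qed
      have "\<forall>j<k. T \<omega>' j = T \<omega> j" if "T \<omega>' \<in> U i" for \<omega>'
      proof (intro allI impI)
        fix j assume "j < k"
        then have "seq_dist (T \<omega>') (T \<omega>) < (1/2) ^ j"
          using dist[OF that] least by (meson le_less_trans)
        then show "T \<omega>' j = T \<omega> j" by (simp add: seq_dist_less_iff_agree)
      qed
      then have sub: "{\<omega>'\<in>A. T \<omega>' \<in> U i} \<subseteq> {\<omega>'\<in>A. \<forall>j<k. T \<omega>' j = T \<omega> j}" by blast
      obtain B where B: "B \<in> sets M" "{\<omega>'\<in>A. \<forall>j<k. T \<omega>' j = T \<omega> j} \<subseteq> B"
          "emeasure M B \<le> ennreal (C * ((1/2) ^ k) powr s)"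
        using cyl[OF \<omega>(1) \<open>k0 \<le> k\<close>] by blast
      have "C * ((1/2) ^ k) powr s \<le> C * r powr s"
        using k \<open>0 \<le> s\<close> \<open>0 < C\<close> by (intro mult_left_mono powr_mono2) auto
      then have "emeasure M B \<le> ennreal (C * r powr s)"
        using B(3) by (meson ennreal_leI order_trans)
      also have "\<dots> = ennreal C * diam_pow seq_dist s (U i)"
        using False r(1) \<open>0 < C\<close> by (simp add: diam_pow ennreal_mult)
      finally show ?thesis using B sub by blast
    next
      case True
      \<comment> \<open>At diameter 0 no single scale fits, so the enclosures at all scales are
        intersected. For \<open>s > 0\<close> the mass vanishes; for \<open>s = 0\<close> it is at
        most \<open>C\<close>, matching the convention that a nonempty set contributes 1.\<close>
      have eq: "T \<omega>' = T \<omega>" if "T \<omega>' \<in> U i" for \<omega>'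
      proof
        fix j
        have "seq_dist (T \<omega>') (T \<omega>) \<le> 0" using dist[OF that] True by simp
        also have "0 < (1/2::real) ^ j" by simp
        finally show "T \<omega>' j = T \<omega> j" by (simp add: seq_dist_less_iff_agree)
      qed
      have "\<forall>k. \<exists>B. B \<in> sets M \<and> {\<omega>'\<in>A. \<forall>j<k0 + k. T \<omega>' j = T \<omega> j} \<subseteq> B \<and>
          emeasure M B \<le> ennreal (C * ((1/2) ^ (k0 + k)) powr s)"
        using cyl[OF \<omega>(1) le_add1] unfolding Bex_def by (rule allI)
      from choice[OF this] obtain B where B: "\<And>k. B k \<in> sets M"
          "\<And>k. {\<omega>'\<in>A. \<forall>j<k0 + k. T \<omega>' j = T \<omega> j} \<subseteq> B k"
          "\<And>k. emeasure M (B k) \<le> ennreal (C * ((1/2) ^ (k0 + k)) powr s)"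
        by blast
      have sub: "{\<omega>'\<in>A. T \<omega>' \<in> U i} \<subseteq> (\<Inter>k. B k)"
        by (intro INT_greatest order_trans[OF _ B(2)]) (auto dest: eq)
      have le: "emeasure M (\<Inter>k. B k) \<le> ennreal (C * ((1/2) ^ (k0 + k)) powr s)" for k
        using B(1) by (intro order_trans[OF emeasure_mono B(3)[of k]]) auto
      have "emeasure M (\<Inter>k. B k) \<le> ennreal C * diam_pow seq_dist s (U i)"
      proof (cases "s = 0")
        case True
        then show ?thesis unfolding diam_pow using le[of 0] by simp
      next
        case False
        have "0 < s" using False \<open>0 \<le> s\<close> by simp
        then have "(\<lambda>k. C * exp (- (real (k0 + k) * (s * ln 2)))) \<longlonglongrightarrow> C * 0"
          by (intro tendsto_mult tendsto_const) real_asymp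
        then have "(\<lambda>k. C * ((1/2) ^ (k0 + k)) powr s) \<longlonglongrightarrow> C * 0"
          unfolding half_power_powr .
        then have "(\<lambda>k. ennreal (C * ((1/2) ^ (k0 + k)) powr s)) \<longlonglongrightarrow> 0"
          using tendsto_ennrealI by (metis ennreal_0 mult_zero_right)
        then have "emeasure M (\<Inter>k. B k) \<le> 0"
          by (rule LIMSEQ_le_const) (intro exI allI impI le)
        then show ?thesis by simp
      qed
      then show ?thesis using sub B(1) by (intro bexI[of _ "\<Inter>k. B k"]) auto
    qed
  qed (auto intro!: bexI[of _ "{}"])
  then obtain B where B: "\<And>i. B i \<in> sets M" "\<And>i. {\<omega>\<in>A. T \<omega> \<in> U i} \<subseteq> B i"
    "\<And>i. emeasure M (B i) \<le> ennreal C * diam_pow seq_dist s (U i)"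
    by metis
  have "A \<subseteq> (\<Union>i. B i)" using U(1) TA B(2) by blast
  then have "emeasure M A \<le> emeasure M (\<Union>i. B i)" using B(1) by (intro emeasure_mono) auto
  also have "\<dots> \<le> (\<Sum>i. emeasure M (B i))"
    using B(1) by (intro emeasure_subadditive_countably) auto
  also have "\<dots> \<le> (\<Sum>i. ennreal C * diam_pow seq_dist s (U i))"
    using B(3) by (intro suminf_le) auto
  also have "\<dots> = ennreal C * (\<Sum>i. diam_pow seq_dist s (U i))" by simp
  also have "\<dots> < ennreal C * ennreal c"
    using small \<open>0 < C\<close> by (intro ennreal_mult_strict_left_mono) auto
  also have "\<dots> = emeasure M A"
    using \<open>0 < C\<close> c by (simp add: c_def emeasure_eq_measure ennreal_mult[symmetric])
  finally show False by simp
qed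

text \<open>Hoeffding's inequality makes the deviation probabilities decay geometrically, so
  Borel-Cantelli applies for each tolerance; the countably many tolerances
  \<open>1 / real (Suc k)\<close> suffice.\<close>

lemma (in prob_space) strong_law_bounded:
  fixes X :: "nat \<Rightarrow> 'a \<Rightarrow> real"
  assumes indep: "indep_vars (\<lambda>_. borel) X UNIV"
    and bound: "\<And>n x. x \<in> space M \<Longrightarrow> \<bar>X n x\<bar> \<le> B"
  shows "AE x in M. (\<lambda>N. (\<Sum>n<N. X n x - expectation (X n)) / real N) \<longlonglongrightarrow> 0"
proof -
  \<comment> \<open>Adding 1 keeps the interval \<open>{- b..b}\<close> nondegenerate even when
    \<open>B = 0\<close>.\<close>
  define b where "b = \<bar>B\<bar> + 1"
  have b: "0 < b" by (simp add: b_def)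
  have [measurable]: "X n \<in> borel_measurable M" for n
    using indep by (simp add: indep_vars_def)
  have "AE x in M. \<forall>\<^sub>F N in sequentially. \<bar>(\<Sum>n<N. X n x - expectation (X n)) / real N\<bar> < e"
    if e: "0 < e" for e :: real
  proof -
    define A where "A N = {x \<in> space M. \<bar>(\<Sum>n<N. X n x) - (\<Sum>n<N. expectation (X n))\<bar> \<ge> real N * e}" for N
    have prob: "measure M (A N) \<le> 2 * exp (- (e\<^sup>2 / (2 * b\<^sup>2))) ^ N" for N
    \<comment> \<open>The Hoeffding bound divides by a sum of \<open>N\<close> squares; for
      \<open>N = 0\<close> the claimed bound is just 2.\<close>
    proof (cases "N = 0")
      case False
      interpret Hoeffding_ineq M "{..<N}" X "\<lambda>_. - b" "\<lambda>_. b" "\<Sum>n<N. expectation (X n)"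
      proof unfold_locales
        show "indep_vars (\<lambda>_. borel) X {..<N}" using indep by (rule indep_vars_subset) auto
        show "AE x in M. X i x \<in> {- b..b}" for i
          using bound[of _ i] by (intro AE_I2) (force simp: b_def abs_le_iff)
      qed auto
      have "measure M (A N) \<le> 2 * exp (- 2 * (real N * e)\<^sup>2 / (\<Sum>i<N. (b - - b)\<^sup>2))"
        unfolding A_def using e b False by (intro Hoeffding_ineq_abs_ge) auto
      also have "- 2 * (real N * e)\<^sup>2 / (\<Sum>i<N. (b - - b)\<^sup>2) = real N * - (e\<^sup>2 / (2 * b\<^sup>2))"
        using False b by (simp add: field_simps power2_eq_square)
      finally show ?thesis by (simp only: exp_of_nat_mult)
    qed (simp, rule order_trans[OF prob_le_1], simp)
    have "AE x in M. \<forall>\<^sub>F N in sequentially. x \<in> space M - A N"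
    proof (rule borel_cantelli_AE1)
      show "A N \<in> sets M" for N unfolding A_def by measurable
      show "summable (\<lambda>N. measure M (A N))"
      proof (rule summable_comparison_test')
        show "summable (\<lambda>N. 2 * exp (- (e\<^sup>2 / (2 * b\<^sup>2))) ^ N)"
          using e b by (intro summable_mult summable_geometric) auto
      qed (use prob in auto)
    qed (simp add: emeasure_eq_measure)
    then show ?thesis
    proof (rule AE_mp, intro AE_I2 impI)
      fix x assume "\<forall>\<^sub>F N in sequentially. x \<in> space M - A N"
      with eventually_gt_at_top[of 0]
      show "\<forall>\<^sub>F N in sequentially. \<bar>(\<Sum>n<N. X n x - expectation (X n)) / real N\<bar> < e"
        by eventually_elim (auto simp: A_def sum_subtractf field_simps)
    qed
  qed
  then have "AE x in M. \<forall>k. \<forall>\<^sub>F N in sequentially.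
      \<bar>(\<Sum>n<N. X n x - expectation (X n)) / real N\<bar> < 1 / real (Suc k)"
    by (subst AE_all_countable) auto
  then show ?thesis
  proof (rule AE_mp, intro AE_I2 impI tendstoI)
    fix x and e :: real
    assume *: "\<forall>k. \<forall>\<^sub>F N in sequentially.
      \<bar>(\<Sum>n<N. X n x - expectation (X n)) / real N\<bar> < 1 / real (Suc k)" and "0 < e"
    obtain k where k: "1 / real (Suc k) < e" using nat_approx_posE[OF \<open>0 < e\<close>] .
    from *[rule_format, of k]
    show "\<forall>\<^sub>F N in sequentially. dist ((\<Sum>n<N. X n x - expectation (X n)) / real N) 0 < e"
      by (rule eventually_mono) (use k in \<open>simp add: dist_real_def\<close>)
  qed
qed

text \<open>The joint law of the coordinates is the product measure itself, hence the product of the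
  marginals.\<close>

lemma indep_vars_PiM_components:
  fixes M :: "'i \<Rightarrow> 'a measure"
  assumes "\<And>i. prob_space (M i)"
  shows "prob_space.indep_vars (PiM UNIV M) M (\<lambda>i \<omega>. \<omega> i) UNIV"
proof -
  interpret M: prob_space "M i" for i by fact
  interpret product_prob_space M UNIV by unfold_locales
  have "distr (PiM UNIV M) (PiM UNIV M) (\<lambda>x. \<lambda>i\<in>UNIV. x i) = PiM UNIV (\<lambda>i. distr (PiM UNIV M) (M i) (\<lambda>\<omega>. \<omega> i))"
    by (simp add: PiM_component restrict_def)
  then show ?thesis by (subst P.indep_vars_iff_distr_eq_PiM') auto
qed

context sign_functions
begin

text \<open>At typical points the cylinder masses decay at the exponential rate
  \<open>P - l * \<alpha>\<close>, faster than \<open>s * ln 2\<close>, so the mass distribution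
  principle applies with exponent \<open>s\<close>.\<close>

lemma hausdorff_measure_level_set_neq_0:
  fixes w :: "nat \<Rightarrow> real"
  assumes bound: "\<And>n. \<bar>w n\<bar> \<le> B"
    and mean: "(\<lambda>N. (\<Sum>n<N. w n * tanh (l * w n)) / real N) \<longlonglongrightarrow> \<alpha>"
    and lnc: "(\<lambda>N. (\<Sum>n<N. ln (2 * cosh (l * w n))) / real N) \<longlonglongrightarrow> P"
    and s: "0 \<le> s" "s * ln 2 < P - l * \<alpha>"
  shows "hausdorff_measure sign_seqs seq_dist s (level_set w f \<alpha>) \<noteq> 0"
proof -
  \<comment> \<open>The probability of the sign +1 under the weights \<open>exp (l * w n)\<close>
    and \<open>exp (- (l * w n))\<close>; \<open>True\<close> encodes +1.\<close>
  define q where "q n = exp (l * w n) / (2 * cosh (l * w n))" for n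
  define \<sigma> where "\<sigma> b = (if b then 1 else -1 :: real)" for b
  define M where "M n = measure_pmf (bernoulli_pmf (q n))" for n
  have c2: "2 * cosh (l * w n) = exp (l * w n) + exp (- (l * w n))" for n
    by (simp add: cosh_def)
  have q: "0 \<le> q n" "q n \<le> 1" for n by (auto simp: q_def c2 field_simps add_pos_pos)
  have q': "1 - q n = exp (- (l * w n)) / (2 * cosh (l * w n))" for n
    unfolding q_def c2 by (simp add: field_simps add_pos_pos[THEN less_imp_neq, symmetric])
  interpret M: prob_space "M n" for n unfolding M_def by (rule prob_space_measure_pmf)
  interpret product_prob_space M UNIV by unfold_locales
  have space: "space (PiM UNIV M) = UNIV" by (simp add: space_PiM M_def)
  have component: "(\<lambda>\<omega>. \<omega> n) \<in> PiM UNIV M \<rightarrow>\<^sub>M M n" for n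
    by (rule measurable_component_singleton) simp
  have [measurable]: "(\<lambda>\<omega>. w n * \<sigma> (\<omega> n)) \<in> borel_measurable (PiM UNIV M)" for n
    by (rule measurable_compose[OF component[of n]]) (auto simp: M_def)
  define S where "S \<omega> N = (\<Sum>n<N. w n * \<sigma> (\<omega> n))" for \<omega> N
  define Z where "Z N = (\<Sum>n<N. ln (2 * cosh (l * w n)))" for N
  have [measurable]: "(\<lambda>\<omega>. S \<omega> N) \<in> borel_measurable (PiM UNIV M)" for N
    unfolding S_def by measurable

  \<comment> \<open>Law of large numbers for the tilted signs\<close>
  have expect: "expectation (\<lambda>\<omega>. w n * \<sigma> (\<omega> n)) = w n * tanh (l * w n)" for n
  proof -
    have "expectation (\<lambda>\<omega>. w n * \<sigma> (\<omega> n)) = (\<integral>b. w n * \<sigma> b \<partial>distr (PiM UNIV M) (M n) (\<lambda>\<omega>. \<omega> n))"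
      by (rule integral_distr[OF component[of n], symmetric]) (simp add: M_def)
    also have "\<dots> = (\<integral>b. w n * \<sigma> b \<partial>measure_pmf (bernoulli_pmf (q n)))"
      by (subst PiM_component) (auto simp: M_def)
    also have "\<dots> = w n * (q n - (1 - q n))"
      using q[of n] by (subst integral_bernoulli_pmf) (auto simp: \<sigma>_def algebra_simps)
    also have "q n - (1 - q n) = tanh (l * w n)"
      unfolding q' unfolding q_def tanh_def sinh_def by (simp add: diff_divide_distrib)
    finally show ?thesis .
  qed
  have "AE \<omega> in PiM UNIV M.
      (\<lambda>N. (\<Sum>n<N. w n * \<sigma> (\<omega> n) - expectation (\<lambda>\<omega>. w n * \<sigma> (\<omega> n))) / real N) \<longlonglongrightarrow> 0"
  proof (rule strong_law_bounded)
    show "indep_vars (\<lambda>_. borel) (\<lambda>n \<omega>. w n * \<sigma> (\<omega> n)) UNIV"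
      using indep_vars_compose2[OF indep_vars_PiM_components[OF M.prob_space_axioms],
          of "\<lambda>n b. w n * \<sigma> b" "\<lambda>_. borel"]
      by (simp add: M_def)
    show "\<bar>w n * \<sigma> (\<omega> n)\<bar> \<le> B" for n \<omega> using bound[of n] by (simp add: \<sigma>_def)
  qed
  then have "AE \<omega> in PiM UNIV M. (\<lambda>N. (S \<omega> N - (\<Sum>n<N. w n * tanh (l * w n))) / real N) \<longlonglongrightarrow> 0"
    unfolding expect sum_subtractf S_def .
  then have "AE \<omega> in PiM UNIV M. (\<lambda>N. S \<omega> N / real N) \<longlonglongrightarrow> \<alpha>"
  proof (rule AE_mp, intro AE_I2 impI)
    fix \<omega> assume "(\<lambda>N. (S \<omega> N - (\<Sum>n<N. w n * tanh (l * w n))) / real N) \<longlonglongrightarrow> 0"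
    from tendsto_add[OF this mean] show "(\<lambda>N. S \<omega> N / real N) \<longlonglongrightarrow> \<alpha>"
      by (simp add: add_divide_distrib[symmetric])
  qed
  then obtain G where G: "G \<in> sets (PiM UNIV M)" "emeasure (PiM UNIV M) G = 1"
    "\<And>\<omega>. \<omega> \<in> G \<Longrightarrow> (\<lambda>N. S \<omega> N / real N) \<longlonglongrightarrow> \<alpha>"
  proof -
    assume *: "AE \<omega> in PiM UNIV M. (\<lambda>N. S \<omega> N / real N) \<longlonglongrightarrow> \<alpha>"
    then obtain Q where Q: "{\<omega> \<in> space (PiM UNIV M). \<not> (\<lambda>N. S \<omega> N / real N) \<longlonglongrightarrow> \<alpha>} \<subseteq> Q"
      "emeasure (PiM UNIV M) Q = 0" "Q \<in> sets (PiM UNIV M)" by (rule AE_E)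
    show thesis
    proof (rule that[of "space (PiM UNIV M) - Q"])
      show "emeasure (PiM UNIV M) (space (PiM UNIV M) - Q) = 1"
        using Q by (subst emeasure_compl) (auto simp: P.emeasure_space_1)
    qed (use Q in auto)
  qed

  \<comment> \<open>On \<open>G\<close> the mass estimate holds from a point-dependent
    \<open>N\<close> on. The sets \<open>A K\<close> make this threshold uniform; they exhaust
    \<open>G\<close>, so one of them has positive mass.\<close>
  define A where "A K = {\<omega> \<in> G. \<forall>N\<ge>K. l * S \<omega> N - Z N \<le> - (real N * (s * ln 2))}" for K
  have A_sets: "A K \<in> sets (PiM UNIV M)" for K
  proof -
    have "A K = G \<inter> {\<omega> \<in> space (PiM UNIV M). \<forall>N\<ge>K. l * S \<omega> N - Z N \<le> - (real N * (s * ln 2))}"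
      using sets.sets_into_space[OF G(1)] by (auto simp: A_def)
    then show ?thesis using G(1) by simp
  qed
  have "G \<subseteq> (\<Union>K. A K)"
  proof
    fix \<omega> assume \<omega>: "\<omega> \<in> G"
    have "(\<lambda>N. Z N / real N - l * (S \<omega> N / real N)) \<longlonglongrightarrow> P - l * \<alpha>"
      using lnc G(3)[OF \<omega>] unfolding Z_def[symmetric] by (intro tendsto_intros)
    then have "\<forall>\<^sub>F N in sequentially. s * ln 2 < Z N / real N - l * (S \<omega> N / real N)"
      using s(2) by (rule order_tendstoD)
    then have "\<forall>\<^sub>F N in sequentially. l * S \<omega> N - Z N \<le> - (real N * (s * ln 2))"
      using eventually_gt_at_top[of 0]
      by eventually_elim (simp add: field_simps)
    then show "\<omega> \<in> (\<Union>K. A K)" using \<omega> by (auto simp: A_def eventually_sequentially)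
  qed
  then have "emeasure (PiM UNIV M) (\<Union>K. A K) \<noteq> 0"
    using emeasure_mono[of G "\<Union>K. A K" "PiM UNIV M"] A_sets G(2) by auto
  then obtain K where K: "emeasure (PiM UNIV M) (A K) \<noteq> 0"
    using emeasure_UN_eq_0[of "PiM UNIV M" A] A_sets by blast

  \<comment> \<open>Passage to points of the level set\<close>
  have "\<exists>x\<in>sign_seqs. \<forall>n. f n x = \<sigma> (\<omega> n)" for \<omega>
    by (rule prescription) (auto simp: sign_seqs_def \<sigma>_def)
  then obtain T where T: "\<And>\<omega>. T \<omega> \<in> sign_seqs" "\<And>\<omega> n. f n (T \<omega>) = \<sigma> (\<omega> n)" by metis

  show ?thesis
  proof (rule P.mass_distribution_seq_dist[OF A_sets K])
    show "T ` A K \<subseteq> level_set w f \<alpha>"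
      using T G(3) by (auto simp: level_set_def A_def S_def)
    show "0 < 2 powr (real L * s)" by simp
    fix \<omega> k assume \<omega>: "\<omega> \<in> A K" and k: "K + L \<le> k"
    \<comment> \<open>Agreement of two points on \<open>k\<close> coordinates guarantees equality of
      their first \<open>k - L\<close> signs. The loss of \<open>L\<close> steps costs the factor
      \<open>2 powr (real L * s)\<close>.\<close>
    define N where "N = k - L"
    have N: "K \<le> N" "k = N + L" using k by (auto simp: N_def)
    define D where "D = {\<omega>' \<in> space (PiM UNIV M). \<forall>n\<in>{..<N}. \<omega>' n \<in> {\<omega> n}}"
    have pmf: "measure (M n) {\<omega> n} = exp (l * (w n * \<sigma> (\<omega> n)) - ln (2 * cosh (l * w n)))" for n
    proof -
      have "measure (M n) {\<omega> n} = pmf (bernoulli_pmf (q n)) (\<omega> n)"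
        by (simp add: M_def measure_pmf_single)
      also have "\<dots> = exp (l * (w n * \<sigma> (\<omega> n))) / (2 * cosh (l * w n))"
        using q[of n] q'[of n] by (cases "\<omega> n") (simp_all add: \<sigma>_def q_def)
      finally show ?thesis by (simp add: exp_diff)
    qed
    have "emeasure (PiM UNIV M) D = (\<Prod>n<N. emeasure (M n) {\<omega> n})"
      unfolding D_def by (rule emeasure_PiM_Collect) (auto simp: M_def)
    also have "\<dots> = ennreal (exp (l * S \<omega> N - Z N))"
      by (simp add: M.emeasure_eq_measure pmf prod_ennreal exp_sum[symmetric] sum_subtractf
          sum_distrib_left S_def Z_def)
    also have "\<dots> \<le> ennreal (exp (- (real N * (s * ln 2))))"
      using \<omega> N by (intro ennreal_leI) (simp add: A_def)
    also have "exp (- (real N * (s * ln 2))) = 2 powr (real L * s) * ((1/2) ^ k) powr s"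
      unfolding half_power_powr by (simp add: powr_def N exp_add[symmetric] algebra_simps)
    finally have "emeasure (PiM UNIV M) D \<le> ennreal (2 powr (real L * s) * ((1/2) ^ k) powr s)" .
    moreover have "{\<omega>'\<in>A K. \<forall>i<k. T \<omega>' i = T \<omega> i} \<subseteq> D"
    proof safe
      fix \<omega>' assume eq: "\<forall>i<k. T \<omega>' i = T \<omega> i"
      have "\<omega>' n = \<omega> n" if "n < N" for n
      proof -
        have "f n (T \<omega>') = f n (T \<omega>)" using eq that N(2) by (intro f_cong T) auto
        then show ?thesis by (simp add: T \<sigma>_def split: if_splits)
      qed
      then show "\<omega>' \<in> D" by (simp add: D_def space)
    qed
    moreover have "D \<in> sets (PiM UNIV M)"
      unfolding D_def by (intro sets.sets_Collect_finite_All sets_Collect_single') (auto simp: M_def)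
    ultimately show "\<exists>B\<in>sets (PiM UNIV M). {\<omega>'\<in>A K. \<forall>i<k. T \<omega>' i = T \<omega> i} \<subseteq> B \<and>
        emeasure (PiM UNIV M) B \<le> ennreal (2 powr (real L * s) * ((1/2) ^ k) powr s)"
      by blast
  qed (use s in auto)
qed

end

section \<open>The dimension formula\<close>

lemma hausdorff_dim_eqI:
  assumes "0 \<le> D"
    and zero: "\<And>s. D < s \<Longrightarrow> hausdorff_measure M d s E = 0"
    and nonzero: "\<And>s. 0 \<le> s \<Longrightarrow> s < D \<Longrightarrow> hausdorff_measure M d s E \<noteq> 0"
  shows "hausdorff_dim M d E = ereal D"
proof (rule antisym)
  have "hausdorff_dim M d E \<le> ereal D + ereal e" if "0 < e" for e
  proof -
    have "0 \<le> D + e" "hausdorff_measure M d (D + e) E = 0"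
      using \<open>0 \<le> D\<close> that by (auto intro: zero)
    then have "ereal (D + e) \<in> {ereal s |s. 0 \<le> s \<and> hausdorff_measure M d s E = 0}" by blast
    then show ?thesis unfolding hausdorff_dim_def plus_ereal.simps(1)
      by (rule Inf_lower)
  qed
  then show "hausdorff_dim M d E \<le> ereal D" by (rule ereal_le_epsilon2)
  show "ereal D \<le> hausdorff_dim M d E"
    unfolding hausdorff_dim_def
  proof (rule Inf_greatest)
    fix y assume "y \<in> {ereal s |s. 0 \<le> s \<and> hausdorff_measure M d s E = 0}"
    then obtain s where s: "y = ereal s" "0 \<le> s" "hausdorff_measure M d s E = 0" by blast
    then have "D \<le> s" using nonzero by (meson not_le)
    then show "ereal D \<le> y" using s(1) by simp
  qed
qed

text \<open>The difference of the two sides is the entropy of the law with weights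
  \<open>exp t\<close> and \<open>exp (- t)\<close>; its sign makes the dimension formula
  nonnegative. It suffices that \<open>\<bar>tanh t\<bar> \<le> 1\<close> and
  \<open>exp \<bar>t\<bar> \<le> 2 * cosh t\<close>.\<close>

lemma mult_tanh_le_ln_2cosh:
  fixes t :: real
  shows "t * tanh t \<le> ln (2 * cosh t)"
proof -
  have "t * tanh t \<le> \<bar>t\<bar> * \<bar>tanh t\<bar>" by (simp add: abs_mult[symmetric])
  also have "\<dots> \<le> \<bar>t\<bar> * 1"
    using tanh_real_bounds[of t] by (intro mult_left_mono) (auto simp: abs_le_iff)
  also have "\<dots> = ln (exp \<bar>t\<bar>)" by simp
  also have "\<dots> \<le> ln (2 * cosh t)"
    by (subst ln_le_cancel_iff) (auto simp: cosh_def abs_if intro: add_pos_pos)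
  finally show ?thesis .
qed

theorem theorem1p5:
  fixes w v p :: "nat \<Rightarrow> real"
    and m :: nat
    and f g :: "nat \<Rightarrow> (nat \<Rightarrow> real) \<Rightarrow> real"
  assumes v_distinct: "inj_on v {..m}"
    and w_values: "range w = v ` {..m}"
    and f_eq: "\<And>n x. x \<in> sign_seqs \<Longrightarrow> f n x = x n * g n (\<lambda>k. x (n + 1 + k))"
    and C1_values: "\<And>n y. y \<in> sign_seqs \<Longrightarrow> g n y \<in> {-1, 1}"
    and C1_dependence: "\<exists>L\<ge>1. \<forall>n. \<forall>y\<in>sign_seqs. \<forall>z\<in>sign_seqs.
           (\<forall>k<L. y k = z k) \<longrightarrow> g n y = g n z"
    and C2: "\<And>j. j \<le> m \<Longrightarrow>
           (\<lambda>N. real (card {n \<in> {1..N}. w n = v j}) / real N) \<longlonglongrightarrow> p j"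
  shows "\<forall>\<alpha>\<in>{- (\<Sum>j\<le>m. p j * \<bar>v j\<bar>) <..< (\<Sum>j\<le>m. p j * \<bar>v j\<bar>)}.
    (\<exists>!lam::real. (\<Sum>j\<le>m. p j * v j *
        ((exp (lam * v j) - exp (- lam * v j)) / (exp (lam * v j) + exp (- lam * v j)))) = \<alpha>) \<and>
    (\<forall>lam::real. (\<Sum>j\<le>m. p j * v j *
        ((exp (lam * v j) - exp (- lam * v j)) / (exp (lam * v j) + exp (- lam * v j)))) = \<alpha> \<longrightarrow>
      hausdorff_dim sign_seqs seq_dist (level_set w f \<alpha>) =
        ereal (1 / ln 2 * (\<Sum>j\<le>m. p j *
          (ln (exp (lam * v j) + exp (- lam * v j)) -
           lam * v j *
             ((exp (lam * v j) - exp (- lam * v j)) / (exp (lam * v j) + exp (- lam * v j)))))))"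
proof -
  obtain L where L: "\<And>n y z. y \<in> sign_seqs \<Longrightarrow> z \<in> sign_seqs \<Longrightarrow>
      (\<And>k. k < L \<Longrightarrow> y k = z k) \<Longrightarrow> g n y = g n z"
    using C1_dependence by metis
  have shift: "(\<lambda>k. x (n + 1 + k)) \<in> sign_seqs" if "x \<in> sign_seqs" for x n
    using that by (simp add: sign_seqs_def)
  interpret sign_functions f L
  proof
    fix x z :: "nat \<Rightarrow> real" and n :: nat
    assume x: "x \<in> sign_seqs"
    have xn: "x n \<in> {-1, 1}" using x by (simp add: sign_seqs_def)
    then show "f n x \<in> {-1, 1}"
      using C1_values[OF shift[OF x, of n], of n] by (auto simp: f_eq[OF x])
    have "x(n := - x n) \<in> sign_seqs" using x xn by (intro sign_seqs_upd) auto
    \<comment> \<open>The shifted sequence starts at coordinate \<open>n + 1\<close>, so the update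
      at \<open>n\<close> leaves the argument of \<open>g n\<close> unchanged.\<close>
    then show "f n (x(n := - x n)) = - f n x" by (simp add: f_eq x)
    assume z: "z \<in> sign_seqs" and eq: "\<And>k. n \<le> k \<Longrightarrow> k \<le> n + L \<Longrightarrow> x k = z k"
    have "g n (\<lambda>k. x (n + 1 + k)) = g n (\<lambda>k. z (n + 1 + k))"
      using eq by (intro L shift x z) auto
    then show "f n x = f n z" using eq[of n] by (simp add: f_eq x z)
  qed
  have p: "0 \<le> p j" if "j \<le> m" for j
    using C2[OF that] by (rule LIMSEQ_le_const) simp
  have tanh: "(exp (l * v j) - exp (- l * v j)) / (exp (l * v j) + exp (- l * v j)) = tanh (l * v j)"
    for l j by (simp add: tanh_altdef)
  have cosh: "exp (l * v j) + exp (- l * v j) = 2 * cosh (l * v j)" for l j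
    by (simp add: cosh_def)
  have avg: "(\<lambda>N. (\<Sum>n<N. h (w n)) / real N) \<longlonglongrightarrow> (\<Sum>j\<le>m. p j * h (v j))" for h
    by (rule average_over_values[OF v_distinct w_values C2])
  have "finite (range w)" using w_values by simp
  then have "bounded (range w)" by (rule finite_imp_bounded)
  then obtain B where B: "\<And>n. \<bar>w n\<bar> \<le> B" by (auto simp: bounded_iff)
  have dim: "hausdorff_dim sign_seqs seq_dist (level_set w f \<alpha>) =
      ereal (1 / ln 2 * (\<Sum>j\<le>m. p j * (ln (2 * cosh (l * v j)) - l * v j * tanh (l * v j))))"
    if \<alpha>: "(\<Sum>j\<le>m. p j * v j * tanh (l * v j)) = \<alpha>" for \<alpha> l
  proof -
    define P where "P = (\<Sum>j\<le>m. p j * ln (2 * cosh (l * v j)))"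
    \<comment> \<open>\<open>D\<close> is the exponent at which \<open>s * ln 2\<close> crosses
      \<open>P - l * \<alpha>\<close>, the common threshold of both bounds.\<close>
    define D where "D = 1 / ln 2 * (\<Sum>j\<le>m. p j * (ln (2 * cosh (l * v j)) - l * v j * tanh (l * v j)))"
    have "D * ln 2 = (\<Sum>j\<le>m. p j * (ln (2 * cosh (l * v j)) - l * v j * tanh (l * v j)))"
      by (simp add: D_def)
    also have "\<dots> = P - l * \<alpha>"
      by (simp add: P_def \<alpha>[symmetric] right_diff_distrib sum_subtractf sum_distrib_left mult_ac)
    finally have D: "D * ln 2 = P - l * \<alpha>" .
    have lnc: "(\<lambda>N. (\<Sum>n<N. ln (2 * cosh (l * w n))) / real N) \<longlonglongrightarrow> P"
      unfolding P_def by (rule avg)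
    have mean: "(\<lambda>N. (\<Sum>n<N. w n * tanh (l * w n)) / real N) \<longlonglongrightarrow> \<alpha>"
      using avg[of "\<lambda>t. t * tanh (l * t)"] \<alpha> by (simp add: mult.assoc)
    have "0 \<le> D" unfolding D_def
      using p mult_tanh_le_ln_2cosh by (intro mult_nonneg_nonneg sum_nonneg) auto
    then have "hausdorff_dim sign_seqs seq_dist (level_set w f \<alpha>) = ereal D"
    proof (rule hausdorff_dim_eqI)
      fix s assume s: "D < s"
      show "hausdorff_measure sign_seqs seq_dist s (level_set w f \<alpha>) = 0"
      proof (rule hausdorff_measure_level_set_eq_0[OF lnc])
        show "P - l * \<alpha> < s * ln 2" unfolding D[symmetric] using s by simp
      qed (use s \<open>0 \<le> D\<close> in simp)
    next
      fix s assume s: "0 \<le> s" "s < D"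
      show "hausdorff_measure sign_seqs seq_dist s (level_set w f \<alpha>) \<noteq> 0"
      proof (rule hausdorff_measure_level_set_neq_0[OF B mean lnc s(1)])
        show "s * ln 2 < P - l * \<alpha>" unfolding D[symmetric] using s by simp
      qed
    qed
    then show ?thesis unfolding D_def .
  qed
  show ?thesis
    \<comment> \<open>The order matters: \<open>cosh\<close> would also rewrite the denominators of
      the fractions that \<open>tanh\<close> has to match.\<close>
    unfolding tanh unfolding cosh
  proof (intro ballI conjI allI impI)
    fix \<alpha>
    assume "\<alpha> \<in> {- (\<Sum>j\<le>m. p j * \<bar>v j\<bar>) <..< (\<Sum>j\<le>m. p j * \<bar>v j\<bar>)}"
    then show "\<exists>!l. (\<Sum>j\<le>m. p j * v j * tanh (l * v j)) = \<alpha>"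
      by (intro weighted_tanh_eq_unique p) simp_all
  qed (rule dim)
qed

end
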